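(* Any nondeterministic finite transducer (NFT) with bounded trailing has an equivalent two-tape deterministic finite automaton (2DFA), i.e., a 2DFA $A$ with $L(A)=L(T)$.
   Context: A two-tape deterministic finite automaton (2DFA) is a tuple $A=(Q,\Sigma,\Gamma,\sqcup,\delta,q_0,F)$ with finite nonempty state set $Q$, finite nonempty input alphabet $\Sigma$ and output alphabet $\Gamma$, a blank (end-delimiter) symbol $\sqcup\notin\Sigma\cup\Gamma$, initial state $q_0$, accepting states $F\subseteq Q$, and a transition function $\delta\colon Q\times(\Sigma\cup\{\sqcup\})\times(\Gamma\cup\{\sqcup\})\to Q\times\{\mathrm{Stay},\mathrm{Advance}\}^2$, $(q,\sigma,\gamma)\mapsto(q',m_1,m_2)$, such that a head reading $\sqcup$ stays, and at least one head advances in each step. The automaton reads a word $a\in\Sigma^*$ on the input tape and $u\in\Gamma^*$ on the output tape (each followed by $\sqcup$) with one one-way head per tape; $(a,u)\in L(A)$ iff the computation ends, when both heads reach the blanks, in an accepting state. A nondeterministic finite transducer (NFT) is $T=(Q,\Sigma,\Gamma,\delta,q_0,F)$ where $\delta$ maps each $(q,\sigma)\in Q\times\Sigma$ to a finite subset of $Q\times\Gamma^*$; on each input symbol it moves to a new state and appends the chosen output word. We write $q\xrightarrow{a/u}q'$ if $T$ can go from $q$ to $q'$ reading $a$ and producing $u$. $L(T)$ is the set of pairs $(a,u)$ such that $q_0\xrightarrow{a/u}f$ for some $f\in F$. $T$ has bounded trailing if there is $t\in\mathbb{N}$ such that for all $q_1,q_2\in Q$, $f_1,f_2\in F$, $a,b_1,b_2\in\Sigma^*$,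 $u,v,w_1,w_2\in\Gamma^*$: if $q_0\xrightarrow{a/uv}q_1\xrightarrow{b_1/w_1}f_1$ and $q_0\xrightarrow{a/u}q_2\xrightarrow{b_2/vw_2}f_2$, then $|v|\le t$. *)

theory Defs
  imports Main
begin

text \<open>
  Alphabet symbols as scanned by a head live in an option type: \<open>None\<close> is the blank
  (end delimiter), which is thereby distinct from all input and output symbols.
\<close>

datatype head_move = Stay | Advance

record ('q, 'a, 'b) two_tape_dfa =
  dfa_states  :: "'q set"
  dfa_input   :: "'a set"
  dfa_output  :: "'b set"
  dfa_delta   :: "'q \<Rightarrow> 'a option \<Rightarrow> 'b option \<Rightarrow> 'q \<times> head_move \<times> head_move"
  dfa_init    :: "'q"
  dfa_final   :: "'q set"

text \<open>
  When both heads scan the blank, neither may move and the computation is over; the requirement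
  that some head advances therefore concerns only the remaining pairs of scanned symbols.
\<close>

definition is_two_tape_dfa :: "('q, 'a, 'b) two_tape_dfa \<Rightarrow> bool" where
  "is_two_tape_dfa A \<longleftrightarrow>
     finite (dfa_states A) \<and> dfa_states A \<noteq> {} \<and>
     finite (dfa_input A) \<and> dfa_input A \<noteq> {} \<and>
     finite (dfa_output A) \<and> dfa_output A \<noteq> {} \<and>
     dfa_init A \<in> dfa_states A \<and> dfa_final A \<subseteq> dfa_states A \<and>
     (\<forall>q \<in> dfa_states A. \<forall>\<sigma> \<in> insert None (Some ` dfa_input A).
        \<forall>\<gamma> \<in> insert None (Some ` dfa_output A). \<forall>q' m1 m2.
          dfa_delta A q \<sigma> \<gamma> = (q', m1, m2) \<longrightarrow>
            q' \<in> dfa_states A \<and>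
            (\<sigma> = None \<longrightarrow> m1 = Stay) \<and> (\<gamma> = None \<longrightarrow> m2 = Stay) \<and>
            (\<sigma> \<noteq> None \<or> \<gamma> \<noteq> None \<longrightarrow> m1 = Advance \<or> m2 = Advance))"

text \<open>
  A tape is represented by the part of its word that has not been passed by the head yet,
  so the empty list means that the head scans the blank.
\<close>

fun scanned :: "'c list \<Rightarrow> 'c option" where
  "scanned [] = None"
| "scanned (c # w) = Some c"

fun move_head :: "head_move \<Rightarrow> 'c list \<Rightarrow> 'c list" where
  "move_head Stay w = w"
| "move_head Advance w = tl w"

inductive dfa_step ::
    "('q, 'a, 'b) two_tape_dfa \<Rightarrow> 'q \<times> 'a list \<times> 'b list \<Rightarrow> 'q \<times> 'a list \<times> 'b list \<Rightarrow> bool"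
  for A where
  "\<lbrakk>x \<noteq> [] \<or> y \<noteq> []; dfa_delta A q (scanned x) (scanned y) = (q', m1, m2)\<rbrakk>
     \<Longrightarrow> dfa_step A (q, x, y) (q', move_head m1 x, move_head m2 y)"

definition dfa_lang :: "('q, 'a, 'b) two_tape_dfa \<Rightarrow> ('a list \<times> 'b list) set" where
  "dfa_lang A = {(a, u). a \<in> lists (dfa_input A) \<and> u \<in> lists (dfa_output A) \<and>
     (\<exists>f \<in> dfa_final A. (dfa_step A)\<^sup>*\<^sup>* (dfa_init A, a, u) (f, [], []))}"

record ('q, 'a, 'b) transducer =
  nft_states  :: "'q set"
  nft_input   :: "'a set"
  nft_output  :: "'b set"
  nft_delta   :: "'q \<Rightarrow> 'a \<Rightarrow> ('q \<times> 'b list) set"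
  nft_init    :: "'q"
  nft_final   :: "'q set"

definition is_nft :: "('q, 'a, 'b) transducer \<Rightarrow> bool" where
  "is_nft T \<longleftrightarrow>
     finite (nft_states T) \<and> nft_states T \<noteq> {} \<and>
     finite (nft_input T) \<and> nft_input T \<noteq> {} \<and>
     finite (nft_output T) \<and> nft_output T \<noteq> {} \<and>
     nft_init T \<in> nft_states T \<and> nft_final T \<subseteq> nft_states T \<and>
     (\<forall>q \<in> nft_states T. \<forall>\<sigma> \<in> nft_input T.
        finite (nft_delta T q \<sigma>) \<and> nft_delta T q \<sigma> \<subseteq> nft_states T \<times> lists (nft_output T))"

inductive nft_run :: "('q, 'a, 'b) transducer \<Rightarrow> 'q \<Rightarrow> 'a list \<Rightarrow> 'b list \<Rightarrow> 'q \<Rightarrow> bool"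
  for T where
  nft_run_Nil: "q \<in> nft_states T \<Longrightarrow> nft_run T q [] [] q"
| nft_run_Cons: "\<lbrakk>q \<in> nft_states T; \<sigma> \<in> nft_input T; (q', v) \<in> nft_delta T q \<sigma>;
     nft_run T q' a u q''\<rbrakk> \<Longrightarrow> nft_run T q (\<sigma> # a) (v @ u) q''"

definition nft_lang :: "('q, 'a, 'b) transducer \<Rightarrow> ('a list \<times> 'b list) set" where
  "nft_lang T = {(a, u). \<exists>f \<in> nft_final T. nft_run T (nft_init T) a u f}"

definition bounded_trailing :: "('q, 'a, 'b) transducer \<Rightarrow> bool" where
  "bounded_trailing T \<longleftrightarrow>
     (\<exists>t :: nat. \<forall>q1 \<in> nft_states T. \<forall>q2 \<in> nft_states T. \<forall>f1 \<in> nft_final T. \<forall>f2 \<in> nft_final T.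
        \<forall>a \<in> lists (nft_input T). \<forall>b1 \<in> lists (nft_input T). \<forall>b2 \<in> lists (nft_input T).
        \<forall>u \<in> lists (nft_output T). \<forall>v \<in> lists (nft_output T).
        \<forall>w1 \<in> lists (nft_output T). \<forall>w2 \<in> lists (nft_output T).
          nft_run T (nft_init T) a (u @ v) q1 \<and> nft_run T q1 b1 w1 f1 \<and>
          nft_run T (nft_init T) a u q2 \<and> nft_run T q2 b2 (v @ w2) f2 \<longrightarrow>
            length v \<le> t)"

end

theory Submission
  imports Defs
begin

text \<open>
  The automaton performs a subset construction. Having read \<open>a\<close> and \<open>y\<close>, it stores for
  each run of \<open>T\<close> on \<open>a\<close> with output \<open>u\<close> that is compatible with \<open>y\<close> the state reached
  and the discrepancy between \<open>u\<close> and \<open>y\<close>, in either direction. It advances the output head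
  as long as some stored run is strictly ahead of \<open>y\<close>, and the input head otherwise.
  Hence a run can get ahead only within one transition of \<open>T\<close>. A run that stays behind \<open>y\<close>
  while another run is ahead of \<open>y\<close> lags by a bounded amount: consider the last moment at which
  the output of the leading run was still a prefix of \<open>y\<close> and apply bounded trailing there.
  So finitely many discrepancies suffice.
\<close>

section \<open>Two-tape automata\<close>

lemma move_head_in_lists: "w \<in> lists X \<Longrightarrow> move_head m w \<in> lists X"
  by (cases m; cases w) auto

lemma scanned_in: "w \<in> lists X \<Longrightarrow> scanned w \<in> insert None (Some ` X)"
  by (cases w) auto

lemma scanned_eq_None_iff [simp]: "scanned w = None \<longleftrightarrow> w = []"
  by (cases w) auto

lemma is_two_tape_dfaD:
  assumes "is_two_tape_dfa A" "q \<in> dfa_states A" "x \<in> lists (dfa_input A)"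
    "y \<in> lists (dfa_output A)" "dfa_delta A q (scanned x) (scanned y) = (q', m1, m2)"
  shows "q' \<in> dfa_states A"
    and "x = [] \<Longrightarrow> m1 = Stay" and "y = [] \<Longrightarrow> m2 = Stay"
    and "x \<noteq> [] \<or> y \<noteq> [] \<Longrightarrow> m1 = Advance \<or> m2 = Advance"
  using assms scanned_in[OF assms(3)] scanned_in[OF assms(4)]
  unfolding is_two_tape_dfa_def by (metis scanned_eq_None_iff)+

text \<open>Every step shortens at least one of the two tapes, so the total remaining length
  decreases. This supplies the halting configuration at which the invariant of the subset automaton
  is evaluated.\<close>

lemma dfa_steps_halt:
  assumes "is_two_tape_dfa A" "q \<in> dfa_states A" "x \<in> lists (dfa_input A)"
    "y \<in> lists (dfa_output A)"
  shows "\<exists>q' \<in> dfa_states A. (dfa_step A)\<^sup>*\<^sup>* (q, x, y) (q', [], [])"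
  using assms(2-)
proof (induction "length x + length y" arbitrary: q x y rule: less_induct)
  case less
  show ?case
  proof (cases "x = [] \<and> y = []")
    case True
    then show ?thesis using less.prems by auto
  next
    case False
    obtain q' m1 m2 where d: "dfa_delta A q (scanned x) (scanned y) = (q', m1, m2)"
      by (metis prod_cases3)
    note D = is_two_tape_dfaD[OF assms(1) less.prems d]
    have "length (move_head m1 x) + length (move_head m2 y) < length x + length y"
      using D False by (cases m1; cases m2; cases x; cases y) auto
    moreover have "dfa_step A (q, x, y) (q', move_head m1 x, move_head m2 y)"
      using False d by (auto intro: dfa_step.intros)
    ultimately show ?thesis
      using less.hyps[of "move_head m1 x" "move_head m2 y" q'] D(1) less.prems
      by (meson converse_rtranclp_into_rtranclp move_head_in_lists)
  qed
qed

text \<open>The subset construction has sets of triples as states, while the theorem asks for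
  natural numbers. A finite state set embeds into \<open>nat\<close>, and computations are
  transported along the embedding.\<close>

lemma dfa_relabel:
  fixes A :: "('s, 'a, 'b) two_tape_dfa"
  assumes A: "is_two_tape_dfa A"
  shows "\<exists>B :: (nat, 'a, 'b) two_tape_dfa. is_two_tape_dfa B \<and>
           dfa_input B = dfa_input A \<and> dfa_output B = dfa_output A \<and> dfa_lang B = dfa_lang A"
proof -
  let ?S = "dfa_states A"
  have basic: "finite ?S" "?S \<noteq> {}" "finite (dfa_input A)" "dfa_input A \<noteq> {}"
      "finite (dfa_output A)" "dfa_output A \<noteq> {}" "dfa_init A \<in> ?S" "dfa_final A \<subseteq> ?S"
    using A unfolding is_two_tape_dfa_def by blast+
  note init = basic(7) and final = basic(8)
  obtain e :: "'s \<Rightarrow> nat" where e: "inj_on e ?S"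
    using finite_imp_inj_to_nat_seg[OF basic(1)] by blast
  \<comment> \<open>Outside the image of \<open>e\<close> the value of \<open>inv_into\<close> is
    arbitrary; computations of \<open>?B\<close> on words over its alphabets start and stay inside
    the image.\<close>
  let ?d = "\<lambda>n \<sigma> \<gamma>. case dfa_delta A (inv_into ?S e n) \<sigma> \<gamma> of (q', m) \<Rightarrow> (e q', m)"
  let ?B = "\<lparr>dfa_states = e ` ?S, dfa_input = dfa_input A, dfa_output = dfa_output A,
     dfa_delta = ?d, dfa_init = e (dfa_init A), dfa_final = e ` dfa_final A\<rparr>"
  have inv: "inv_into ?S e (e q) = q" if "q \<in> ?S" for q
    using e that by simp
  have delta: "q' \<in> ?S \<and> (\<sigma> = None \<longrightarrow> m1 = Stay) \<and> (\<gamma> = None \<longrightarrow> m2 = Stay) \<and>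
      (\<sigma> \<noteq> None \<or> \<gamma> \<noteq> None \<longrightarrow> m1 = Advance \<or> m2 = Advance)"
    if "q \<in> ?S" "\<sigma> \<in> insert None (Some ` dfa_input A)"
      "\<gamma> \<in> insert None (Some ` dfa_output A)" "dfa_delta A q \<sigma> \<gamma> = (q', m1, m2)" for q \<sigma> \<gamma> q' m1 m2
    using A that unfolding is_two_tape_dfa_def by blast
  have B: "is_two_tape_dfa ?B"
    unfolding is_two_tape_dfa_def
  proof (intro conjI ballI allI impI)
    fix n \<sigma> \<gamma> n' m1 m2
    assume n: "n \<in> dfa_states ?B" and \<sigma>: "\<sigma> \<in> insert None (Some ` dfa_input ?B)"
      and \<gamma>: "\<gamma> \<in> insert None (Some ` dfa_output ?B)"
      and step: "dfa_delta ?B n \<sigma> \<gamma> = (n', m1, m2)"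
    from n obtain q where q: "q \<in> ?S" "n = e q" by auto
    with step have "(case dfa_delta A q \<sigma> \<gamma> of (q', m) \<Rightarrow> (e q', m)) = (n', m1, m2)"
      by (simp add: inv)
    then obtain q' where q': "dfa_delta A q \<sigma> \<gamma> = (q', m1, m2)" "n' = e q'"
      by (cases "dfa_delta A q \<sigma> \<gamma>") auto
    have *: "q' \<in> ?S \<and> (\<sigma> = None \<longrightarrow> m1 = Stay) \<and> (\<gamma> = None \<longrightarrow> m2 = Stay) \<and>
        (\<sigma> \<noteq> None \<or> \<gamma> \<noteq> None \<longrightarrow> m1 = Advance \<or> m2 = Advance)"
      by (rule delta[OF q(1) _ _ q'(1)]) (use \<sigma> \<gamma> in simp_all)
    show "n' \<in> dfa_states ?B" using * q' by simp
    show "m1 = Stay" if "\<sigma> = None" using * that by blast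
    show "m2 = Stay" if "\<gamma> = None" using * that by blast
    show "m1 = Advance \<or> m2 = Advance" if "\<sigma> \<noteq> None \<or> \<gamma> \<noteq> None" using * that by blast
  qed (use basic in \<open>simp_all add: image_mono\<close>)
  \<comment> \<open>Membership of the state and of both tapes is carried along because
    \<open>A\<close> is controlled only on its own states and symbols.\<close>
  have fwd: "(dfa_step ?B)\<^sup>*\<^sup>* (e (dfa_init A), a, u) (e q, x, y) \<and> q \<in> ?S \<and>
      x \<in> lists (dfa_input A) \<and> y \<in> lists (dfa_output A)"
    if "(dfa_step A)\<^sup>*\<^sup>* (dfa_init A, a, u) (q, x, y)"
      "a \<in> lists (dfa_input A)" "u \<in> lists (dfa_output A)" for a u q x y
    using that
  proof (induction "(q, x, y)" arbitrary: q x y rule: rtranclp_induct)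
    case base
    then show ?case using init by auto
  next
    case (step p)
    obtain r x' y' where p: "p = (r, x', y')" by (metis prod_cases3)
    note IH = step(3)[OF p step.prems]
    from step(2) p obtain m1 m2 where *: "x' \<noteq> [] \<or> y' \<noteq> []"
        "dfa_delta A r (scanned x') (scanned y') = (q, m1, m2)"
        "x = move_head m1 x'" "y = move_head m2 y'"
      by (auto elim: dfa_step.cases)
    have "dfa_step ?B (e r, x', y') (e q, x, y)"
      unfolding *(3,4) by (rule dfa_step.intros) (use * IH inv in auto)
    moreover have "x \<in> lists (dfa_input A)" "y \<in> lists (dfa_output A)"
      unfolding *(3,4) using IH by (simp_all only: move_head_in_lists)
    ultimately show ?case
      using IH * is_two_tape_dfaD(1)[OF A, of r x' y' q m1 m2]
      by (auto intro: rtranclp.rtrancl_into_rtrancl)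
  qed
  have bwd: "\<exists>q. n = e q \<and> (dfa_step A)\<^sup>*\<^sup>* (dfa_init A, a, u) (q, x, y) \<and> q \<in> ?S \<and>
      x \<in> lists (dfa_input A) \<and> y \<in> lists (dfa_output A)"
    if "(dfa_step ?B)\<^sup>*\<^sup>* (e (dfa_init A), a, u) (n, x, y)"
      "a \<in> lists (dfa_input A)" "u \<in> lists (dfa_output A)" for a u n x y
    using that
  proof (induction "(n, x, y)" arbitrary: n x y rule: rtranclp_induct)
    case base
    then show ?case using init by auto
  next
    case (step p)
    obtain m x' y' where p: "p = (m, x', y')" by (metis prod_cases3)
    obtain r where IH: "m = e r" "(dfa_step A)\<^sup>*\<^sup>* (dfa_init A, a, u) (r, x', y')" "r \<in> ?S"
        "x' \<in> lists (dfa_input A)" "y' \<in> lists (dfa_output A)"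
      using step(3)[OF p step.prems] by auto
    from step(2) p IH inv obtain q m1 m2 where *: "x' \<noteq> [] \<or> y' \<noteq> []"
        "dfa_delta A r (scanned x') (scanned y') = (q, m1, m2)" "n = e q"
        "x = move_head m1 x'" "y = move_head m2 y'"
      by (auto elim!: dfa_step.cases split: prod.splits)
    have "dfa_step A (r, x', y') (q, x, y)"
      unfolding *(4,5) by (rule dfa_step.intros) (use * in auto)
    moreover have "x \<in> lists (dfa_input A)" "y \<in> lists (dfa_output A)"
      unfolding *(4,5) using IH by (simp_all only: move_head_in_lists)
    ultimately show ?case
      using IH * is_two_tape_dfaD(1)[OF A, of r x' y' q m1 m2]
      by (auto intro: rtranclp.rtrancl_into_rtrancl)
  qed
  have "dfa_lang ?B = dfa_lang A"
  proof (rule set_eqI, clarify)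
    fix a u
    show "(a, u) \<in> dfa_lang ?B \<longleftrightarrow> (a, u) \<in> dfa_lang A"
    proof
      assume "(a, u) \<in> dfa_lang ?B"
      then obtain f where *: "a \<in> lists (dfa_input A)" "u \<in> lists (dfa_output A)"
          "f \<in> dfa_final A" "(dfa_step ?B)\<^sup>*\<^sup>* (e (dfa_init A), a, u) (e f, [], [])"
        by (auto simp: dfa_lang_def)
      with bwd obtain q where "e f = e q" "q \<in> ?S"
          "(dfa_step A)\<^sup>*\<^sup>* (dfa_init A, a, u) (q, [], [])"
        by blast
      moreover have "q = f"
        using e \<open>e f = e q\<close> \<open>q \<in> ?S\<close> * final by (metis inj_onD subsetD)
      ultimately show "(a, u) \<in> dfa_lang A"
        using * by (auto simp: dfa_lang_def)
    next
      assume "(a, u) \<in> dfa_lang A"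
      then show "(a, u) \<in> dfa_lang ?B"
        using fwd by (fastforce simp: dfa_lang_def)
    qed
  qed
  with B show ?thesis by (intro exI[of _ ?B]) simp
qed

section \<open>Runs of transducers\<close>

lemma is_nftD:
  assumes "is_nft T"
  shows "finite (nft_states T)" "finite (nft_input T)" "nft_input T \<noteq> {}"
    "finite (nft_output T)" "nft_output T \<noteq> {}" "nft_init T \<in> nft_states T"
    and "\<lbrakk>q \<in> nft_states T; \<sigma> \<in> nft_input T\<rbrakk> \<Longrightarrow> finite (nft_delta T q \<sigma>)"
    and "\<lbrakk>q \<in> nft_states T; \<sigma> \<in> nft_input T; (q', v) \<in> nft_delta T q \<sigma>\<rbrakk>
      \<Longrightarrow> q' \<in> nft_states T \<and> v \<in> lists (nft_output T)"
  using assms unfolding is_nft_def by blast+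

lemma nft_run_in_states:
  assumes "is_nft T" "nft_run T q a u q'"
  shows "q \<in> nft_states T" "q' \<in> nft_states T"
    "a \<in> lists (nft_input T)" "u \<in> lists (nft_output T)"
  using assms(2)
proof (induction rule: nft_run.induct)
  case (nft_run_Cons q \<sigma> q' v a u q'')
  {
    case 4
    then show ?case using nft_run_Cons is_nftD(8)[OF assms(1)] by fastforce
  }
qed auto

inductive_cases nft_run_NilE: "nft_run T q [] u q'"
inductive_cases nft_run_ConsE: "nft_run T q (\<sigma> # a) w r"

lemma nft_run_Nil_iff [simp]: "nft_run T q [] u q' \<longleftrightarrow> u = [] \<and> q' = q \<and> q \<in> nft_states T"
  by (metis nft_run_NilE nft_run_Nil)

lemma nft_run_Cons_iff:
  "nft_run T q (\<sigma> # a) w r \<longleftrightarrow> (\<exists>p x v. w = x @ v \<and> q \<in> nft_states T \<and> \<sigma> \<in> nft_input T \<and>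
     (p, x) \<in> nft_delta T q \<sigma> \<and> nft_run T p a v r)"
  by (metis nft_run_ConsE nft_run_Cons)

lemma nft_run_append:
  assumes "nft_run T q a u p" "nft_run T p b w r"
  shows "nft_run T q (a @ b) (u @ w) r"
  using assms by (induction rule: nft_run.induct) (auto intro: nft_run.intros)

lemma nft_run_appendE:
  assumes "is_nft T" "nft_run T q (a @ b) w r"
  obtains p u v where "w = u @ v" "nft_run T q a u p" "nft_run T p b v r"
proof -
  have "\<exists>p u v. w = u @ v \<and> nft_run T q a u p \<and> nft_run T p b v r"
    using assms(2)
  proof (induction a arbitrary: q w)
    case Nil
    then show ?case
      using nft_run_in_states[OF assms(1)] by (metis append_Nil nft_run_Nil)
  next
    case (Cons \<sigma> a)
    from Cons.prems obtain q' x w' where *: "w = x @ w'" "q \<in> nft_states T" "\<sigma> \<in> nft_input T"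
        "(q', x) \<in> nft_delta T q \<sigma>" "nft_run T q' (a @ b) w' r"
      by (auto simp: nft_run_Cons_iff)
    with Cons.IH obtain p u v where "w' = u @ v" "nft_run T q' a u p" "nft_run T p b v r"
      by blast
    with * show ?case
      by (intro exI[of _ p] exI[of _ "x @ u"] exI[of _ v]) (auto intro: nft_run.intros)
  qed
  then show thesis using that by blast
qed

text \<open>There are only finitely many transitions in total, so their output lengths are
  bounded.\<close>

lemma nft_output_bounded:
  assumes "is_nft T"
  obtains K where "\<And>q \<sigma> q' x. \<lbrakk>q \<in> nft_states T; \<sigma> \<in> nft_input T; (q', x) \<in> nft_delta T q \<sigma>\<rbrakk>
    \<Longrightarrow> length x \<le> K"
proof -
  let ?X = "\<Union>(q, \<sigma>) \<in> nft_states T \<times> nft_input T. nft_delta T q \<sigma>"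
  have "finite ?X"
    by (rule finite_UN_I) (use is_nftD(1,2,7)[OF assms] in \<open>auto split: prod.splits\<close>)
  then have "finite ((length \<circ> snd) ` ?X)" by (rule finite_imageI)
  then obtain K where K: "\<forall>n \<in> (length \<circ> snd) ` ?X. n \<le> K"
    by (auto simp only: finite_nat_set_iff_bounded_le)
  show thesis
  proof (rule that)
    fix q \<sigma> q' x
    assume "q \<in> nft_states T" "\<sigma> \<in> nft_input T" "(q', x) \<in> nft_delta T q \<sigma>"
    then have "(q', x) \<in> ?X" by blast
    then have "(length \<circ> snd) (q', x) \<le> K" using K by blast
    then show "length x \<le> K" by simp
  qed
qed

section \<open>The subset construction\<close>

locale trailing_nft =
  fixes T :: "('q, 'a, 'b) transducer" and t K :: nat
  assumes nft: "is_nft T"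
    and trailing: "\<lbrakk>nft_run T (nft_init T) a (u @ v) q1; nft_run T q1 b1 w1 f1; f1 \<in> nft_final T;
       nft_run T (nft_init T) a u q2; nft_run T q2 b2 (v @ w2) f2; f2 \<in> nft_final T\<rbrakk>
       \<Longrightarrow> length v \<le> t"
    and out_le: "\<lbrakk>q \<in> nft_states T; \<sigma> \<in> nft_input T; (q', x) \<in> nft_delta T q \<sigma>\<rbrakk> \<Longrightarrow> length x \<le> K"
begin

abbreviation run where "run \<equiv> nft_run T"
abbreviation q0 where "q0 \<equiv> nft_init T"

section \<open>Bounding the lag of a run behind the output tape\<close>

lemmas run_in = nft_run_in_states[OF nft]

text \<open>Bounded trailing constrains only runs that can be continued to acceptance, so the
  automaton stores no others.\<close>

definition coaccessible :: "'q \<Rightarrow> bool" where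
  "coaccessible q \<longleftrightarrow> (\<exists>b w. \<exists>f \<in> nft_final T. run q b w f)"

lemma run_coaccessible: "run p a u q \<Longrightarrow> coaccessible q \<Longrightarrow> coaccessible p"
  unfolding coaccessible_def by (meson nft_run_append)

text \<open>Remove the last input letter from both runs. If the leading run already covered
  \<open>y\<close> before it, induct. Otherwise \<open>y\<close> exceeds the earlier output
  \<open>u1\<close> by at most one transition, hence by \<open>K\<close>, and \<open>u1\<close>
  exceeds the earlier output \<open>u'\<close> of the other run by at most \<open>t\<close>.\<close>

lemma lag_bounded:
  assumes "run q0 a (y @ z) q1" "coaccessible q1"
    and "run q0 a u q" "run q b w f" "f \<in> nft_final T" "u @ w = y @ r"
  shows "length y \<le> length u + t + K"
  using assms
proof (induction a arbitrary: z q1 u q b w rule: rev_induct)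
  case Nil
  then show ?case by simp
next
  case (snoc \<sigma> a)
  obtain p1 u1 x1 where 1: "y @ z = u1 @ x1" "run q0 a u1 p1" "run p1 [\<sigma>] x1 q1"
    using snoc.prems(1) by (rule nft_run_appendE[OF nft])
  obtain p u' x where 2: "u = u' @ x" "run q0 a u' p" "run p [\<sigma>] x q"
    using snoc.prems(3) by (rule nft_run_appendE[OF nft])
  have co: "coaccessible p1"
    using 1(3) snoc.prems(2) by (rule run_coaccessible)
  have p: "run p ([\<sigma>] @ b) (x @ w) f"
    using 2(3) snoc.prems(4) by (rule nft_run_append)
  show ?case
  proof (cases "length y \<le> length u1")
    case True
    then obtain z' where "u1 = y @ z'"
      using 1(1) by (auto simp: append_eq_append_conv2)
    \<comment> \<open>The removed letter and its output move to the continuation of the lagging run,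
      so the hypothesis on \<open>y @ r\<close> is preserved.\<close>
    then have "length y \<le> length u' + t + K"
      using snoc.IH[of z' p1 u' p "[\<sigma>] @ b" "x @ w"] 1(2) 2 co p snoc.prems by simp
    then show ?thesis using 2(1) by simp
  next
    case False
    then obtain y2 where y2: "y = u1 @ y2" "y2 @ z = x1"
      using 1(1) by (auto simp: append_eq_append_conv2)
    have "length x1 \<le> K"
      using 1(3) out_le by (auto simp: nft_run_Cons_iff)
    then have le: "length y \<le> length u1 + K" using y2 by auto
    show ?thesis
    proof (cases "length u1 \<le> length u'")
      case True
      then show ?thesis using le 2(1) by simp
    next
      case False
      have eq: "u' @ (x @ w) = u1 @ (y2 @ r)"
        using snoc.prems(6) 2(1) y2(1) by simp
      with False obtain v where v: "u1 = u' @ v" "x @ w = v @ (y2 @ r)"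
        by (auto simp: append_eq_append_conv2)
      obtain b1 w1 f1 where "run p1 b1 w1 f1" "f1 \<in> nft_final T"
        using co by (auto simp: coaccessible_def)
      \<comment> \<open>Bounded trailing is applied before \<open>\<sigma>\<close> is read: the
        outputs are \<open>u' @ v\<close> and \<open>u'\<close>, and the second run goes on to
        produce \<open>v\<close>.\<close>
      with v 1 2 p snoc.prems(5) have "length v \<le> t"
        by (intro trailing[of a u' v p1 b1 w1 f1 p "[\<sigma>] @ b" "y2 @ r" f]) auto
      then show ?thesis using le v 2(1) by simp
    qed
  qed
qed

text \<open>
  A triple \<open>(q, z, v)\<close> represents a run with output \<open>u\<close> that ends in \<open>q\<close>, where
  \<open>u @ v = y @ z\<close> for the part \<open>y\<close> of the output tape read so far: the run is ahead by \<open>z\<close> or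
  behind by \<open>v\<close>.
\<close>

definition discrepancies :: "('q \<times> 'b list \<times> 'b list) set" where
  "discrepancies = {(q, z, v). q \<in> nft_states T \<and> coaccessible q \<and>
     z \<in> lists (nft_output T) \<and> v \<in> lists (nft_output T) \<and>
     length z \<le> K \<and> length v \<le> t + K + 1 \<and> (z = [] \<or> v = [])}"

text \<open>The intersection keeps the state set finite. It loses no run that accepts the two tapes,
  provided that some stored run is ahead or the input is exhausted.\<close>

definition read_output where
  "read_output s c = ({(q, z, v). (q, c # z, v) \<in> s} \<union> {(q, [], v @ [c]) | q v. (q, [], v) \<in> s})
     \<inter> discrepancies"

text \<open>As \<open>discrepancies\<close> forces \<open>z'\<close> or \<open>v'\<close> to be
  empty, the equation cancels the new output \<open>x\<close> against the debt \<open>v\<close>; the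
  run is dropped if neither word is a prefix of the other.\<close>

definition read_input where
  "read_input s \<sigma> = {(q', z', v'). \<exists>q v x. (q, [], v) \<in> s \<and> (q', x) \<in> nft_delta T q \<sigma> \<and>
     x @ v' = v @ z'} \<inter> discrepancies"

definition ahead where
  "ahead s \<longleftrightarrow> (\<exists>q c z v. (q, c # z, v) \<in> s)"

text \<open>
  If the output tape is exhausted, runs that are ahead can no longer accept, and
  \<^const>\<open>read_input\<close> drops them.
\<close>

fun delta where
  "delta s None None = (s, Stay, Stay)"
| "delta s None (Some c) = (read_output s c, Stay, Advance)"
| "delta s (Some \<sigma>) None = (read_input s \<sigma>, Advance, Stay)"
| "delta s (Some \<sigma>) (Some c) =
     (if ahead s then (read_output s c, Stay, Advance) else (read_input s \<sigma>, Advance, Stay))"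

text \<open>The intersection in the initial state matters when \<open>q0\<close> is not
  coaccessible, that is, when \<open>T\<close> accepts nothing.\<close>

definition subset_dfa :: "(('q \<times> 'b list \<times> 'b list) set, 'a, 'b) two_tape_dfa" where
  "subset_dfa = \<lparr>dfa_states = Pow discrepancies, dfa_input = nft_input T,
     dfa_output = nft_output T, dfa_delta = delta, dfa_init = {(q0, [], [])} \<inter> discrepancies,
     dfa_final = {s \<in> Pow discrepancies. \<exists>q \<in> nft_final T. (q, [], []) \<in> s}\<rparr>"

section \<open>The subset automaton is a two-tape automaton\<close>

lemma finite_discrepancies: "finite discrepancies"
proof (rule finite_subset)
  let ?L = "\<lambda>n. {w. set w \<subseteq> nft_output T \<and> length w \<le> n}"
  show "discrepancies \<subseteq> nft_states T \<times> ?L K \<times> ?L (t + K + 1)"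
    by (auto simp: discrepancies_def)
  show "finite (nft_states T \<times> ?L K \<times> ?L (t + K + 1))"
    using is_nftD[OF nft] by (intro finite_cartesian_product finite_lists_length_le) auto
qed

lemma is_two_tape_dfa_subset_dfa: "is_two_tape_dfa subset_dfa"
proof -
  note is_nftD(2-5)[OF nft]
  moreover have "q' \<subseteq> discrepancies \<and> (\<sigma> = None \<longrightarrow> m1 = Stay) \<and> (\<gamma> = None \<longrightarrow> m2 = Stay) \<and>
      (\<sigma> \<noteq> None \<or> \<gamma> \<noteq> None \<longrightarrow> m1 = Advance \<or> m2 = Advance)"
    if "q \<subseteq> discrepancies" "delta q \<sigma> \<gamma> = (q', m1, m2)" for q \<sigma> \<gamma> q' m1 m2
    using that by (cases \<sigma>; cases \<gamma>)
      (auto simp: read_output_def read_input_def split: if_splits)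
  ultimately show ?thesis
    using finite_discrepancies unfolding is_two_tape_dfa_def subset_dfa_def by auto
qed

section \<open>Soundness and completeness of the stored set\<close>

definition sound where
  "sound s a y \<longleftrightarrow> s \<subseteq> discrepancies \<and>
     (\<forall>(q, z, v) \<in> s. \<exists>u. run q0 a u q \<and> u @ v = y @ z)"

text \<open>Only runs that accept with the unread tapes \<open>b\<close> and \<open>r\<close> are
  required to be stored, since the lag bound is available only for them.\<close>

definition complete where
  "complete s a y b r \<longleftrightarrow> (\<forall>u q w. \<forall>f \<in> nft_final T. run q0 a u q \<and> run q b w f \<and> u @ w = y @ r \<longrightarrow>
     (\<exists>z v. (q, z, v) \<in> s \<and> u @ v = y @ z))"

lemma sound_read_output:
  assumes "sound s a y"
  shows "sound (read_output s c) a (y @ [c])"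
  unfolding sound_def
proof (intro conjI ballI)
  show "read_output s c \<subseteq> discrepancies" by (auto simp: read_output_def)
  fix p assume "p \<in> read_output s c"
  moreover obtain q z v where "p = (q, z, v)" by (metis prod_cases3)
  ultimately show "case p of (q, z, v) \<Rightarrow> \<exists>u. run q0 a u q \<and> u @ v = (y @ [c]) @ z"
    using assms by (fastforce simp: read_output_def sound_def)
qed

lemma sound_read_input:
  assumes "sound s a y" "\<sigma> \<in> nft_input T"
  shows "sound (read_input s \<sigma>) (a @ [\<sigma>]) y"
proof -
  have "\<exists>u. run q0 (a @ [\<sigma>]) u q' \<and> u @ v' = y @ z'"
    if in_s: "(q, [], v) \<in> s" and step: "(q', x) \<in> nft_delta T q \<sigma>" "x @ v' = v @ z'"
    for q v q' x z' v'
  proof -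
    obtain u where u: "run q0 a u q" "u @ v = y"
      using assms(1) in_s by (fastforce simp: sound_def)
    have q: "q \<in> nft_states T" using u run_in by blast
    then have "q' \<in> nft_states T" using step(1) assms(2) is_nftD(8)[OF nft] by blast
    with q step(1) assms(2) have "run q [\<sigma>] x q'" by (auto simp: nft_run_Cons_iff)
    with u(1) have "run q0 (a @ [\<sigma>]) (u @ x) q'" by (rule nft_run_append)
    with u(2) step(2) show ?thesis by (intro exI[of _ "u @ x"]) auto
  qed
  then show ?thesis by (fastforce simp: sound_def read_input_def)
qed

text \<open>An accepting run that is ahead must have \<open>c\<close> as its next surplus symbol.
  For any other accepting run, a stored run that is ahead serves as the leading run in
  \<open>lag_bounded\<close>, so the extended debt still fits.\<close>

lemma complete_read_output:
  assumes s: "sound s a y" "complete s a y b (c # r)"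
    and tape: "y @ c # r \<in> lists (nft_output T)"
    and ahead: "ahead s \<or> b = []"
  shows "complete (read_output s c) a (y @ [c]) b r"
  unfolding complete_def
proof (intro allI ballI impI, elim conjE)
  fix u q w f
  assume f: "f \<in> nft_final T" and run: "run q0 a u q" "run q b w f" and eq: "u @ w = (y @ [c]) @ r"
  then obtain z v where zv: "(q, z, v) \<in> s" "u @ v = y @ z"
    using s(2) by (fastforce simp: complete_def)
  have d: "(q, z, v) \<in> discrepancies" using zv s by (auto simp: sound_def)
  show "\<exists>z v. (q, z, v) \<in> read_output s c \<and> u @ v = (y @ [c]) @ z"
  proof (cases z)
    case (Cons c' z')
    then have "v = []" using d by (auto simp: discrepancies_def)
    then have "c' = c" using eq zv Cons by auto
    then have "(q, z', v) \<in> read_output s c"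
      using zv d Cons by (auto simp: read_output_def discrepancies_def)
    then show ?thesis using zv Cons \<open>c' = c\<close> by auto
  next
    case Nil
    have y: "y = u @ v" using zv Nil by simp
    \<comment> \<open>With no input left the output could not grow any more, yet \<open>c\<close> is
      still missing from it.\<close>
    have "b \<noteq> []" using run eq y by auto
    then obtain q1 c1 z1 v1 where 1: "(q1, c1 # z1, v1) \<in> s"
      using ahead by (auto simp: ahead_def)
    then have d1: "(q1, c1 # z1, v1) \<in> discrepancies" using s by (auto simp: sound_def)
    then have "v1 = []" "coaccessible q1" by (auto simp: discrepancies_def)
    moreover obtain u1 where "run q0 a u1 q1" "u1 @ v1 = y @ (c1 # z1)"
      using 1 s(1) by (fastforce simp: sound_def)
    ultimately have "length y \<le> length u + t + K"
      using lag_bounded[of a y "c1 # z1" q1 u q b w f "c # r"] run f eq by simp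
    \<comment> \<open>One symbol of slack remains for \<open>c\<close>, which is why
      \<open>discrepancies\<close> allows debts up to \<open>t + K + 1\<close>.\<close>
    then have "length v \<le> t + K" using y by simp
    then have "(q, [], v @ [c]) \<in> read_output s c"
      using zv d Nil tape by (auto simp: read_output_def discrepancies_def)
    then show ?thesis using y by auto
  qed
qed

text \<open>No accepting run is ahead at this point, so \<open>read_input\<close> extends all of
  them. A new surplus is part of a single transition output and a new debt is part of the old one,
  so the bounds persist.\<close>

lemma complete_read_input:
  assumes s: "sound s a y" "complete s a y (\<sigma> # b) r"
    and ahead: "\<not> ahead s \<or> r = []"
  shows "complete (read_input s \<sigma>) (a @ [\<sigma>]) y b r"
  unfolding complete_def
proof (intro allI ballI impI, elim conjE)
  fix u' q' w f
  assume f: "f \<in> nft_final T" and run: "run q0 (a @ [\<sigma>]) u' q'" "run q' b w f"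
    and eq: "u' @ w = y @ r"
  obtain q u x where u: "u' = u @ x" "run q0 a u q" "run q [\<sigma>] x q'"
    using run(1) by (rule nft_run_appendE[OF nft])
  have "run q (\<sigma> # b) (x @ w) f" using nft_run_append[OF u(3) run(2)] by simp
  then obtain z v where zv: "(q, z, v) \<in> s" "u @ v = y @ z"
    using s(2) f eq u by (fastforce simp: complete_def)
  have d: "(q, z, v) \<in> discrepancies" using zv s by (auto simp: sound_def)
  have z: "z = []"
  proof (cases "r = []")
    case True
    \<comment> \<open>With the output tape exhausted, an accepting run has produced a prefix of
      \<open>y\<close>, which excludes a nonempty surplus.\<close>
    then show ?thesis using eq u(1) zv d by (auto simp: discrepancies_def)
  next
    case False
    then show ?thesis using ahead zv by (cases z) (auto simp: ahead_def)
  qed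
  have x: "(q', x) \<in> nft_delta T q \<sigma>" "length x \<le> K"
    using u(3) out_le by (auto simp: nft_run_Cons_iff)
  have co: "q' \<in> nft_states T" "coaccessible q'"
    using run f run_in by (auto simp: coaccessible_def)
  have "x @ w = v @ r" using eq u(1) zv z by auto
  \<comment> \<open>Both \<open>x\<close> and \<open>v\<close> are prefixes of the same word, hence
    one is a prefix of the other.\<close>
  then obtain z' v' where zv': "x @ v' = v @ z'" "z' = [] \<or> v' = []"
    by (auto simp: append_eq_append_conv2)
  have "x \<in> lists (nft_output T)" using u(3) run_in by blast
  moreover have "x = v @ z' \<and> v' = [] \<or> v = x @ v' \<and> z' = []" using zv' by auto
  ultimately have "(q', z', v') \<in> discrepancies"
    using d co x(2) by (auto simp: discrepancies_def)
  then have "(q', z', v') \<in> read_input s \<sigma>"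
    using zv z x zv' by (auto simp: read_input_def)
  then show "\<exists>z v. (q', z, v) \<in> read_input s \<sigma> \<and> u' @ v = y @ z"
    using zv z zv' u(1) by (intro exI[of _ z'] exI[of _ v']) auto
qed

section \<open>Correctness of the subset automaton\<close>

lemma dfa_steps_invariant:
  assumes "a0 \<in> lists (nft_input T)" "u0 \<in> lists (nft_output T)"
    and "(dfa_step subset_dfa)\<^sup>*\<^sup>* (dfa_init subset_dfa, a0, u0) (s, b, r)"
  shows "\<exists>a y. a0 = a @ b \<and> u0 = y @ r \<and> sound s a y \<and> complete s a y b r"
  using assms(3)
proof (induction "(s, b, r)" arbitrary: s b r rule: rtranclp_induct)
  case base
  have init: "dfa_init subset_dfa = {(q0, [], [])} \<inter> discrepancies"
    by (simp add: subset_dfa_def)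
  have "q0 \<in> nft_states T" using nft by (rule is_nftD)
  \<comment> \<open>On empty input the only run is the empty one, and any accepting continuation of
    it makes \<open>q0\<close> coaccessible.\<close>
  then have "sound (dfa_init subset_dfa) [] []" "complete (dfa_init subset_dfa) [] [] a0 u0"
    by (auto simp: init sound_def complete_def discrepancies_def coaccessible_def)
  then show ?case by auto
next
  case (step p)
  obtain s' b' r' where p: "p = (s', b', r')" by (metis prod_cases3)
  obtain a y where IH: "a0 = a @ b'" "u0 = y @ r'" "sound s' a y" "complete s' a y b' r'"
    using step(3)[OF p] by auto
  obtain m1 m2 where *: "b' \<noteq> [] \<or> r' \<noteq> []" "delta s' (scanned b') (scanned r') = (s, m1, m2)"
      "b = move_head m1 b'" "r = move_head m2 r'"
    using step(2) p by (auto elim: dfa_step.cases simp: subset_dfa_def)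
  \<comment> \<open>The side conditions that \<open>delta\<close> guarantees are exactly those under
    which the two completeness lemmas apply.\<close>
  consider c where "r' = c # r" "b' = b" "s = read_output s' c" "ahead s' \<or> b = []"
    | \<sigma> where "b' = \<sigma> # b" "r' = r" "s = read_input s' \<sigma>" "\<not> ahead s' \<or> r = []"
    using * by (cases b'; cases r') (auto split: if_splits)
  then show ?case
  proof cases
    case 1
    then show ?thesis
      using IH sound_read_output[of s' a y c] complete_read_output[of s' a y b c r] assms(2)
      by (intro exI[of _ a] exI[of _ "y @ [c]"]) auto
  next
    case 2
    then show ?thesis
      using IH sound_read_input[of s' a y \<sigma>] complete_read_input[of s' a y \<sigma> b r] assms(1)
      by (intro exI[of _ "a @ [\<sigma>]"] exI[of _ y]) auto
  qed
qed

text \<open>At a halting configuration soundness turns a final triple into an accepting run of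
  \<open>T\<close>, and completeness puts the triple of each accepting run into the reached
  set.\<close>

lemma dfa_lang_subset_dfa: "dfa_lang subset_dfa = nft_lang T"
proof (rule set_eqI, clarify)
  fix a u
  have io: "dfa_input subset_dfa = nft_input T" "dfa_output subset_dfa = nft_output T"
    by (simp_all add: subset_dfa_def)
  show "(a, u) \<in> dfa_lang subset_dfa \<longleftrightarrow> (a, u) \<in> nft_lang T"
  proof
    assume "(a, u) \<in> dfa_lang subset_dfa"
    then obtain s where s: "a \<in> lists (nft_input T)" "u \<in> lists (nft_output T)"
        "s \<in> dfa_final subset_dfa"
        "(dfa_step subset_dfa)\<^sup>*\<^sup>* (dfa_init subset_dfa, a, u) (s, [], [])"
      by (auto simp: dfa_lang_def io)
    then have "sound s a u" using dfa_steps_invariant by fastforce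
    with s(3) show "(a, u) \<in> nft_lang T"
      by (fastforce simp: subset_dfa_def sound_def nft_lang_def)
  next
    assume "(a, u) \<in> nft_lang T"
    then obtain f where f: "f \<in> nft_final T" "run q0 a u f" by (auto simp: nft_lang_def)
    then have au: "a \<in> lists (nft_input T)" "u \<in> lists (nft_output T)" "f \<in> nft_states T"
      using run_in by blast+
    have "dfa_init subset_dfa \<in> dfa_states subset_dfa"
      using is_two_tape_dfa_subset_dfa by (simp add: is_two_tape_dfa_def)
    then obtain s where s: "s \<in> dfa_states subset_dfa"
        "(dfa_step subset_dfa)\<^sup>*\<^sup>* (dfa_init subset_dfa, a, u) (s, [], [])"
      using dfa_steps_halt[OF is_two_tape_dfa_subset_dfa] au io by metis
    then have "complete s a u [] []" using dfa_steps_invariant au by fastforce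
    then obtain z v where zv: "(f, z, v) \<in> s" "u @ v = u @ z"
      using f au by (fastforce simp: complete_def)
    \<comment> \<open>The equation gives \<open>v = z\<close>, and one of the two is empty by
      \<open>discrepancies\<close>.\<close>
    then have "z = [] \<and> v = []" using s(1) by (auto simp: subset_dfa_def discrepancies_def)
    then show "(a, u) \<in> dfa_lang subset_dfa"
      using zv s f au unfolding dfa_lang_def io by (auto simp: subset_dfa_def)
  qed
qed

end

theorem theorem1:
  fixes T :: "('q, 'a, 'b) transducer"
  assumes "is_nft T" and "bounded_trailing T"
  shows "\<exists>A :: (nat, 'a, 'b) two_tape_dfa.
           is_two_tape_dfa A \<and>
           dfa_input A = nft_input T \<and> dfa_output A = nft_output T \<and>
           dfa_lang A = nft_lang T"
proof -
  obtain K where K: "\<And>q \<sigma> q' x. \<lbrakk>q \<in> nft_states T; \<sigma> \<in> nft_input T; (q', x) \<in> nft_delta T q \<sigma>\<rbrakk>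
      \<Longrightarrow> length x \<le> K"
    using nft_output_bounded[OF assms(1)] by blast
  obtain t where t: "\<And>q1 q2 f1 f2 a b1 b2 u v w1 w2.
      \<lbrakk>q1 \<in> nft_states T; q2 \<in> nft_states T; f1 \<in> nft_final T; f2 \<in> nft_final T;
       a \<in> lists (nft_input T); b1 \<in> lists (nft_input T); b2 \<in> lists (nft_input T);
       u \<in> lists (nft_output T); v \<in> lists (nft_output T);
       w1 \<in> lists (nft_output T); w2 \<in> lists (nft_output T);
       nft_run T (nft_init T) a (u @ v) q1; nft_run T q1 b1 w1 f1;
       nft_run T (nft_init T) a u q2; nft_run T q2 b2 (v @ w2) f2\<rbrakk> \<Longrightarrow> length v \<le> t"
    using assms(2) unfolding bounded_trailing_def by (elim exE) meson
  interpret trailing_nft T t K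
  proof
    fix a u v q1 b1 w1 f1 q2 b2 w2 f2
    assume *: "nft_run T (nft_init T) a (u @ v) q1" "nft_run T q1 b1 w1 f1" "f1 \<in> nft_final T"
      "nft_run T (nft_init T) a u q2" "nft_run T q2 b2 (v @ w2) f2" "f2 \<in> nft_final T"
    \<comment> \<open>The memberships of states and words required by
      \<open>bounded_trailing\<close> are read off the four runs.\<close>
    note run_in = *(1,2,4,5)[THEN nft_run_in_states(2)[OF assms(1)]]
      *(1,2,4,5)[THEN nft_run_in_states(3)[OF assms(1)]]
      *(1,2,4,5)[THEN nft_run_in_states(4)[OF assms(1)]]
    show "length v \<le> t"
      by (rule t[OF _ _ *(3,6) _ _ _ _ _ _ _ *(1,2,4,5)]) (use run_in in auto)
  qed (use assms K in auto)
  show ?thesis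
    using dfa_relabel[OF is_two_tape_dfa_subset_dfa] dfa_lang_subset_dfa
    by (simp add: subset_dfa_def)
qed

end
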